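(* Consider the spatially flat Friedmann cosmological model with a classical massive scalar field $\Phi(t)$ of mass $m$, zero cosmological constant and $H=\dot a/a\ge 0$, governed by the scalar field equation and the Einstein equation $$\ddot\Phi+3\frac{\dot a}{a}\dot\Phi+m^2\Phi=0,\qquad 3\frac{\dot a^2}{a^2}=8\pi\left(\dot\Phi^2+m^2\Phi^2\right).$$ In the variables $\tau=mt$, $\Phi$, $Z=d\Phi/d\tau$ these equations form the autonomous dynamic system on the plane $(\Phi,Z)$ $$\frac{d\Phi}{d\tau}=Z,\qquad \frac{dZ}{d\tau}=-\sqrt{24\pi}\,\sqrt{Z^2+\Phi^2}\;Z-\Phi .$$ The phase space of this dynamic system has a single center, $M_0=(0,0)$ (that is, $\Phi_0=0$, $Z_0=0$), where $$t\to+\infty\ \Rightarrow\ \Phi\to 0,\quad \dot\Phi\to 0\ \Rightarrow\ H\to 0 .$$ Thus the system does not come to a mode of constant inflation; on the contrary, its expansion stops and the Universe becomes flat.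
   Context: Units are $\hbar=c=G=1$. The metric is $ds^2=dt^2-a^2(t)(dx^2+dy^2+dz^2)$ with scale factor $a(t)$; a dot denotes $d/dt$. $\Phi$ is a real homogeneous scalar field, $m$ is the mass of its quanta, and $H=\dot a/a$ is the Hubble constant (a function of $t$). On the branch $H\ge 0$ the Einstein equation gives $H=m\sqrt{8\pi/3}\,\sqrt{Z^2+\Phi^2}$. Constant inflation means $a(t)\propto e^{H_0t}$ with constant $H_0>0$. "The Universe becomes flat" means that the space-time geometry tends asymptotically to Minkowski geometry; elsewhere the paper describes this as $H(+\infty)\to 0$, $a(+\infty)\to\mathrm{Const}$.
   Formalization: "Center" means eigenvalues ±iω of the linearization (orbits are not closed); "becomes flat" means the metric tends to Minkowski on bounded time spans about late epochs, with H and da/dt tending to 0; a→Const is not claimed, since a is unbounded unless the field vanishes. *)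

theory Defs
  imports "HOL-Analysis.Analysis"
begin

definition hubble :: "(real \<Rightarrow> real) \<Rightarrow> real \<Rightarrow> real" where
  "hubble a t = deriv a t / a t"

text \<open>
  Solutions live on an open half-line, because they need not extend to all earlier times (backwards
  in time they may run into the initial singularity). No second derivative of the scale factor is
  assumed.
\<close>

definition friedmann_scalar_solution ::
  "real \<Rightarrow> real \<Rightarrow> (real \<Rightarrow> real) \<Rightarrow> (real \<Rightarrow> real) \<Rightarrow> bool" where
  "friedmann_scalar_solution m t0 a \<Phi> \<longleftrightarrow>
     (\<forall>t>t0. a t > 0 \<and> a differentiable (at t) \<and> hubble a t \<ge> 0
           \<and> \<Phi> differentiable (at t) \<and> deriv \<Phi> differentiable (at t)
           \<and> deriv (deriv \<Phi>) t + 3 * (deriv a t / a t) * deriv \<Phi> t + m\<^sup>2 * \<Phi> t = 0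
           \<and> 3 * (deriv a t)\<^sup>2 / (a t)\<^sup>2 = 8 * pi * ((deriv \<Phi> t)\<^sup>2 + m\<^sup>2 * (\<Phi> t)\<^sup>2))"


text \<open>The phase plane: component 1 is the field, component 2 its derivative by \<open>\<tau> = m t\<close>.\<close>

definition phase_field :: "real^2 \<Rightarrow> real^2" where
  "phase_field M = vector [M $ 2, - sqrt (24 * pi) * sqrt ((M $ 2)\<^sup>2 + (M $ 1)\<^sup>2) * M $ 2 - M $ 1]"

definition solves_from :: "(real^'n \<Rightarrow> real^'n) \<Rightarrow> real \<Rightarrow> (real \<Rightarrow> real^'n) \<Rightarrow> bool" where
  "solves_from F \<tau>0 x \<longleftrightarrow> (\<forall>\<tau>>\<tau>0. (x has_vector_derivative F (x \<tau>)) (at \<tau>))"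

definition scaled_field :: "real \<Rightarrow> (real \<Rightarrow> real) \<Rightarrow> real \<Rightarrow> real" where
  "scaled_field m \<Phi> \<tau> = \<Phi> (\<tau> / m)"

definition phase_curve :: "real \<Rightarrow> (real \<Rightarrow> real) \<Rightarrow> real \<Rightarrow> real^2" where
  "phase_curve m \<Phi> \<tau> = vector [scaled_field m \<Phi> \<tau>, deriv (scaled_field m \<Phi>) \<tau>]"


definition complex_eigenvalue :: "real^'n^'n \<Rightarrow> complex \<Rightarrow> bool" where
  "complex_eigenvalue A \<mu> \<longleftrightarrow>
     (\<exists>v :: complex^'n. v \<noteq> 0 \<and> map_matrix complex_of_real A *v v = \<mu> *s v)"

text \<open>
  \<open>Center\<close> is the type of a singular point in the classification by the eigenvalues of the
  linearised system: a conjugate pair of nonzero, purely imaginary eigenvalues. It does not mean that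
  the orbits of the nonlinear system around the point are closed; for \<^const>\<open>phase_field\<close> they
  converge to it.
\<close>

definition is_center :: "(real^2 \<Rightarrow> real^2) \<Rightarrow> real^2 \<Rightarrow> bool" where
  "is_center F M \<longleftrightarrow> F M = 0 \<and> F differentiable (at M) \<and>
     (\<exists>\<omega>>0. {\<mu>. complex_eigenvalue (matrix (frechet_derivative F (at M))) \<mu>}
              = {\<i> * complex_of_real \<omega>, - \<i> * complex_of_real \<omega>})"


text \<open>
  A model comes to constant inflation with rate \<open>H0\<close> if its Hubble function tends to \<open>H0\<close>, or if the
  scale factor is asymptotically (in particular: eventually exactly) proportional to \<open>exp (H0 t)\<close>.
\<close>

definition comes_to_constant_inflation :: "(real \<Rightarrow> real) \<Rightarrow> bool" where
  "comes_to_constant_inflation a \<longleftrightarrow>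
     (\<exists>H0>0. (hubble a \<longlongrightarrow> H0) at_top \<or>
             (\<exists>C>0. ((\<lambda>t. a t / exp (H0 * t)) \<longlongrightarrow> C) at_top))"

text \<open>
  Both the relative and the absolute expansion rate vanish in the limit. This does not make the scale
  factor bounded: nonconstant solutions grow on average like \<open>t\<close> to the power \<open>2 / 3\<close>.
\<close>

definition expansion_stops :: "(real \<Rightarrow> real) \<Rightarrow> bool" where
  "expansion_stops a \<longleftrightarrow> (hubble a \<longlongrightarrow> 0) at_top \<and> (deriv a \<longlongrightarrow> 0) at_top"


text \<open>
  Space-time is \<open>\<real> \<times> \<real>\<^sup>3\<close>; a metric assigns to each event a bilinear form on tangent vectors.
\<close>

type_synonym spacetime = "real \<times> (real^3)"
type_synonym metric = "spacetime \<Rightarrow> spacetime \<Rightarrow> spacetime \<Rightarrow> real"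

definition friedmann_metric :: "(real \<Rightarrow> real) \<Rightarrow> metric" where
  "friedmann_metric a p u v = fst u * fst v - (a (fst p))\<^sup>2 * (snd u \<bullet> snd v)"

definition minkowski_metric :: metric where
  "minkowski_metric p u v = fst u * fst v - snd u \<bullet> snd v"

definition pullback_metric :: "(spacetime \<Rightarrow> spacetime) \<Rightarrow> metric \<Rightarrow> metric" where
  "pullback_metric \<psi> g p u v =
     g (\<psi> p) (frechet_derivative \<psi> (at p) u) (frechet_derivative \<psi> (at p) v)"

text \<open>
  Coordinates adapted to the epoch \<open>T\<close>: time is counted from \<open>T\<close>, and at that moment the space
  coordinates measure proper length.
\<close>

definition epoch_chart :: "(real \<Rightarrow> real) \<Rightarrow> real \<Rightarrow> spacetime \<Rightarrow> spacetime" where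
  "epoch_chart a T p = (T + fst p, snd p /\<^sub>R a T)"

text \<open>
  In coordinates adapted to \<open>T\<close>, the metric components and their first two derivatives converge to
  those of the Minkowski metric, uniformly on bounded time spans, as \<open>T\<close> tends to infinity. In
  particular the curvature vanishes in the limit. Only time derivatives occur, because both metrics
  are homogeneous in space.
\<close>

definition asymptotically_minkowski :: "(real \<Rightarrow> real) \<Rightarrow> bool" where
  "asymptotically_minkowski a \<longleftrightarrow>
     (\<forall>k\<le>2. \<forall>y u v L. uniform_limit {-L..L}
        (\<lambda>T. (deriv ^^ k) (\<lambda>s. pullback_metric (epoch_chart a T) (friedmann_metric a) (s, y) u v))
        ((deriv ^^ k) (\<lambda>s. minkowski_metric (s, y) u v))
        at_top)"

end

theory Submission
  imports Defs
begin

text \<open>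
  In the phase plane the Einstein equation turns the Hubble function into \<open>H = m \<kappa> r\<close> with
  \<open>\<kappa> = sqrt (8 \<pi> / 3)\<close> and \<open>r\<close> the distance from the origin, so the field is an oscillator with
  friction \<open>3 \<kappa> r\<close>. Since \<open>(r\<^sup>2)' = - 6 \<kappa> r z\<^sup>2\<close>, the distance decreases, and a Lyapunov function shows
  that it decreases to zero. On average over a late oscillation \<open>z\<^sup>2\<close> is about half of \<open>r\<^sup>2\<close>, so
  \<open>r\<close> decays like \<open>a\<close> to the power \<open>- 3 / 2\<close>, faster than \<open>a\<close> grows; hence \<open>a r\<close>, which is proportional to the
  derivative of \<open>a\<close>, tends to zero even if \<open>a\<close> is unbounded. The derivative of \<open>H\<close> is proportional to
  \<open>z\<^sup>2\<close>, so it tends to zero as well, and the metric coefficient \<open>(a (T + s) / a T)\<^sup>2\<close> with its first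
  two derivatives is controlled by \<open>H\<close> and its derivative.
\<close>

section \<open>An oscillator with friction proportional to its amplitude\<close>

lemma abs_mult_le_half_sum_squares: "\<bar>x * y\<bar> \<le> (x\<^sup>2 + y\<^sup>2) / (2::real)"
proof -
  have "0 \<le> (\<bar>x\<bar> - \<bar>y\<bar>)\<^sup>2" by simp
  then show ?thesis by (simp add: power2_diff abs_mult)
qed

text \<open>For \<kappa> = \<open>sqrt (8 * pi / 3)\<close> the coefficient
  \<open>3 * \<kappa>\<close> is the \<open>sqrt (24 * pi)\<close> of \<open>phase_field\<close>.
  Two real functions stand in for the plane curve, so that the rules for real derivatives apply
  directly.\<close>

locale damped_oscillator =
  fixes \<kappa> \<tau>0 :: real and \<phi> z :: "real \<Rightarrow> real"
  assumes \<kappa>_pos: "\<kappa> > 0"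
    and deriv_\<phi>: "\<And>\<tau>. \<tau> > \<tau>0 \<Longrightarrow> (\<phi> has_real_derivative z \<tau>) (at \<tau>)"
    and deriv_z: "\<And>\<tau>. \<tau> > \<tau>0 \<Longrightarrow>
      (z has_real_derivative - (3 * \<kappa> * sqrt ((z \<tau>)\<^sup>2 + (\<phi> \<tau>)\<^sup>2) * z \<tau>) - \<phi> \<tau>) (at \<tau>)"
begin

definition r :: "real \<Rightarrow> real" where
  "r \<tau> = sqrt ((z \<tau>)\<^sup>2 + (\<phi> \<tau>)\<^sup>2)"

lemma r_nonneg [simp]: "r \<tau> \<ge> 0"
  by (simp add: r_def)

lemma r_power2: "(r \<tau>)\<^sup>2 = (z \<tau>)\<^sup>2 + (\<phi> \<tau>)\<^sup>2"
  by (simp add: r_def)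

lemma abs_\<phi>_le: "\<bar>\<phi> \<tau>\<bar> \<le> r \<tau>" and abs_z_le: "\<bar>z \<tau>\<bar> \<le> r \<tau>"
  by (simp_all add: r_def real_le_rsqrt)

lemma abs_\<phi>_mult_z_le: "\<bar>\<phi> \<tau> * z \<tau>\<bar> \<le> (r \<tau>)\<^sup>2 / 2"
  using abs_mult_le_half_sum_squares[of "\<phi> \<tau>" "z \<tau>"] by (simp add: r_power2 add.commute)

lemma deriv_z': "\<tau> > \<tau>0 \<Longrightarrow> (z has_real_derivative - (3 * \<kappa> * r \<tau> * z \<tau>) - \<phi> \<tau>) (at \<tau>)"
  using deriv_z by (simp add: r_def)

text \<open>The conservative parts of the two equations cancel and only friction remains. The square
  is used because \<open>r\<close> itself, a square root, need not be differentiable where it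
  vanishes.\<close>

lemma deriv_r_power2:
  assumes "\<tau> > \<tau>0"
  shows "((\<lambda>\<tau>. (r \<tau>)\<^sup>2) has_real_derivative - 6 * \<kappa> * r \<tau> * (z \<tau>)\<^sup>2) (at \<tau>)"
  unfolding r_power2
  by (auto intro!: derivative_eq_intros deriv_\<phi> deriv_z' assms simp: algebra_simps power2_eq_square)

text \<open>The part \<open>z^2 - \<phi>^2\<close> trades one coordinate for the other: the Lyapunov
  function gains decay in \<phi> from it, and the averaged energy \<open>q\<close> uses it to
  replace \<open>z^2\<close> by half of \<open>r^2\<close>.\<close>

lemma deriv_\<phi>_mult_z:
  assumes "\<tau> > \<tau>0"
  shows "((\<lambda>\<tau>. \<phi> \<tau> * z \<tau>) has_real_derivative
    (z \<tau>)\<^sup>2 - (\<phi> \<tau>)\<^sup>2 - 3 * \<kappa> * r \<tau> * z \<tau> * \<phi> \<tau>) (at \<tau>)"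
  by (auto intro!: derivative_eq_intros deriv_\<phi> deriv_z' assms simp: algebra_simps power2_eq_square)

section \<open>Monotone decay of the distance from the origin to zero\<close>

lemma r_antimono:
  assumes "\<tau>0 < \<sigma>" "\<sigma> \<le> \<tau>"
  shows "r \<tau> \<le> r \<sigma>"
proof -
  have "(r \<tau>)\<^sup>2 \<le> (r \<sigma>)\<^sup>2"
  proof (rule DERIV_nonpos_imp_nonincreasing[OF assms(2)])
    fix x assume "\<sigma> \<le> x"
    moreover have "- 6 * \<kappa> * r x * (z x)\<^sup>2 \<le> 0"
      using \<kappa>_pos by simp
    ultimately show "\<exists>y. ((\<lambda>\<tau>. (r \<tau>)\<^sup>2) has_real_derivative y) (at x) \<and> y \<le> 0"
      using deriv_r_power2[of x] assms by auto
  qed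
  then show ?thesis
    by (rule power2_le_imp_le) simp
qed

text \<open>
  The friction degenerates on the axis \<open>z = 0\<close>, so the energy \<open>r\<^sup>2\<close> alone is not strictly
  decreasing; adding a small multiple of \<open>\<phi> z\<close> makes it decrease at a uniform rate
  as long as \<open>r\<close> stays away from zero.
\<close>

lemma r_arbitrarily_small:
  assumes "c > 0"
  shows "\<exists>\<tau>>\<tau>0. r \<tau> < c"
proof (rule ccontr)
  assume "\<not> ?thesis"
  then have low: "c \<le> r \<tau>" if "\<tau> > \<tau>0" for \<tau>
    using that by force
  define \<tau>1 where "\<tau>1 = \<tau>0 + 1"
  define R where "R = r \<tau>1"
  \<comment> \<open>This \<epsilon> makes the total coefficient of \<open>z^2\<close> coming from
    the cross term, \<open>3 / 2 * \<epsilon> * (1 + 3 * \<kappa>^2 * R^2)\<close>, equal to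
    \<open>6 * \<kappa> * c\<close>, which friction supplies while \<open>r\<close> is at least
    \<open>c\<close>.\<close>
  define \<epsilon> where "\<epsilon> = 4 * \<kappa> * c / (1 + 3 * \<kappa>\<^sup>2 * R\<^sup>2)"
  \<comment> \<open>The linear term encodes the rate: once \<open>V\<close> is nonincreasing, the
    modified energy falls at least with slope \<open>\<epsilon> * c^2 / 2\<close>.\<close>
  define V where "V \<tau> = (r \<tau>)\<^sup>2 + \<epsilon> * (\<phi> \<tau> * z \<tau>) + \<epsilon> * c\<^sup>2 / 2 * (\<tau> - \<tau>1)" for \<tau>
  have den: "1 + 3 * \<kappa>\<^sup>2 * R\<^sup>2 > 0"
    by (simp add: add_pos_nonneg)
  then have \<epsilon>: "\<epsilon> > 0" "\<epsilon> * (1 + 3 * \<kappa>\<^sup>2 * R\<^sup>2) = 4 * \<kappa> * c"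
    using \<kappa>_pos assms by (auto simp: \<epsilon>_def)
  have up: "r \<tau> \<le> R" if "\<tau> \<ge> \<tau>1" for \<tau>
    using r_antimono[of \<tau>1 \<tau>] that by (simp add: \<tau>1_def R_def)
  have dV: "(V has_real_derivative - 6 * \<kappa> * r \<tau> * (z \<tau>)\<^sup>2
       + \<epsilon> * ((z \<tau>)\<^sup>2 - (\<phi> \<tau>)\<^sup>2 - 3 * \<kappa> * r \<tau> * z \<tau> * \<phi> \<tau>) + \<epsilon> * c\<^sup>2 / 2) (at \<tau>)"
    if "\<tau> > \<tau>0" for \<tau>
    unfolding V_def
    by (intro DERIV_add deriv_r_power2 DERIV_cmult deriv_\<phi>_mult_z that)
      (auto intro!: derivative_eq_intros)
  have dV_le: "- 6 * \<kappa> * r \<tau> * (z \<tau>)\<^sup>2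
       + \<epsilon> * ((z \<tau>)\<^sup>2 - (\<phi> \<tau>)\<^sup>2 - 3 * \<kappa> * r \<tau> * z \<tau> * \<phi> \<tau>) + \<epsilon> * c\<^sup>2 / 2 \<le> 0"
    if "\<tau> \<ge> \<tau>1" for \<tau>
  proof -
    have t0: "\<tau> > \<tau>0" using that by (simp add: \<tau>1_def)
    \<comment> \<open>Young's inequality costs only half of the gained \<open>\<phi>^2\<close>; the
      rest is a multiple of \<open>z^2\<close>, bounded by means of
      \<open>r \<le> R\<close>.\<close>
    have "- (3 * \<kappa> * r \<tau> * z \<tau>) * \<phi> \<tau> \<le> ((3 * \<kappa> * r \<tau> * z \<tau>)\<^sup>2 + (\<phi> \<tau>)\<^sup>2) / 2"
      using abs_mult_le_half_sum_squares[of "- (3 * \<kappa> * r \<tau> * z \<tau>)" "\<phi> \<tau>"] by simp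
    also have "(3 * \<kappa> * r \<tau> * z \<tau>)\<^sup>2 \<le> (3 * \<kappa> * R)\<^sup>2 * (z \<tau>)\<^sup>2"
      unfolding power_mult_distrib using up[OF that] \<kappa>_pos
      by (intro mult_right_mono mult_left_mono power_mono) auto
    finally have "(z \<tau>)\<^sup>2 - (\<phi> \<tau>)\<^sup>2 - 3 * \<kappa> * r \<tau> * z \<tau> * \<phi> \<tau>
        \<le> (z \<tau>)\<^sup>2 - (\<phi> \<tau>)\<^sup>2 / 2 + (3 * \<kappa> * R)\<^sup>2 * (z \<tau>)\<^sup>2 / 2"
      by simp
    then have "\<epsilon> * ((z \<tau>)\<^sup>2 - (\<phi> \<tau>)\<^sup>2 - 3 * \<kappa> * r \<tau> * z \<tau> * \<phi> \<tau>)
        \<le> \<epsilon> * ((z \<tau>)\<^sup>2 - (\<phi> \<tau>)\<^sup>2 / 2 + (3 * \<kappa> * R)\<^sup>2 * (z \<tau>)\<^sup>2 / 2)"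
      using \<epsilon> by (intro mult_left_mono) auto
    also have "\<dots> = 3 / 2 * (\<epsilon> * (1 + 3 * \<kappa>\<^sup>2 * R\<^sup>2)) * (z \<tau>)\<^sup>2 - \<epsilon> / 2 * (r \<tau>)\<^sup>2"
      by (simp add: r_power2 algebra_simps power_mult_distrib)
    also have "\<dots> = 6 * \<kappa> * c * (z \<tau>)\<^sup>2 - \<epsilon> / 2 * (r \<tau>)\<^sup>2"
      by (simp add: \<epsilon>(2))
    finally have 1: "\<epsilon> * ((z \<tau>)\<^sup>2 - (\<phi> \<tau>)\<^sup>2 - 3 * \<kappa> * r \<tau> * z \<tau> * \<phi> \<tau>)
        \<le> 6 * \<kappa> * c * (z \<tau>)\<^sup>2 - \<epsilon> / 2 * (r \<tau>)\<^sup>2" .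
    have 2: "6 * \<kappa> * c * (z \<tau>)\<^sup>2 \<le> 6 * \<kappa> * r \<tau> * (z \<tau>)\<^sup>2"
      using low[OF t0] \<kappa>_pos by (intro mult_right_mono mult_left_mono) auto
    have 3: "\<epsilon> / 2 * c\<^sup>2 \<le> \<epsilon> / 2 * (r \<tau>)\<^sup>2"
      using low[OF t0] \<epsilon> assms by (intro mult_left_mono power_mono) auto
    from 1 2 3 show ?thesis by simp
  qed
  have V_le: "V \<tau> \<le> V \<tau>1" if "\<tau> \<ge> \<tau>1" for \<tau>
    by (rule DERIV_nonpos_imp_nonincreasing[OF that])
      (use dV dV_le in \<open>force simp: \<tau>1_def\<close>)
  have xz: "\<bar>\<epsilon> * (\<phi> \<tau> * z \<tau>)\<bar> \<le> \<epsilon> * R\<^sup>2" if "\<tau> \<ge> \<tau>1" for \<tau>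
  proof -
    have "(r \<tau>)\<^sup>2 \<le> R\<^sup>2"
      using up[OF that] by (intro power_mono) auto
    then have "\<bar>\<phi> \<tau> * z \<tau>\<bar> \<le> R\<^sup>2"
      using abs_\<phi>_mult_z_le[of \<tau>] zero_le_power2[of R] by linarith
    then show ?thesis
      using \<epsilon> by (simp add: abs_mult[of \<epsilon>] mult_left_mono)
  qed
  have bound: "\<epsilon> * c\<^sup>2 / 2 * (\<tau> - \<tau>1) \<le> R\<^sup>2 + 2 * (\<epsilon> * R\<^sup>2)" if "\<tau> \<ge> \<tau>1" for \<tau>
  proof -
    have "V \<tau>1 = R\<^sup>2 + \<epsilon> * (\<phi> \<tau>1 * z \<tau>1)"
      by (simp add: V_def R_def)
    with V_le[OF that] abs_le_D2[OF xz[OF that]] abs_le_D1[OF xz[OF order_refl]]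
      zero_le_power2[of "r \<tau>"]
    show ?thesis
      unfolding V_def[of \<tau>] by linarith
  qed
  have "\<epsilon> * c\<^sup>2 / 2 > 0"
    using \<epsilon> assms by simp
  \<comment> \<open>At this time the linear term exceeds its upper bound by exactly 1.\<close>
  moreover define \<tau>2 where "\<tau>2 = \<tau>1 + (R\<^sup>2 + 2 * (\<epsilon> * R\<^sup>2) + 1) / (\<epsilon> * c\<^sup>2 / 2)"
  ultimately have "\<tau>2 \<ge> \<tau>1" "\<epsilon> * c\<^sup>2 / 2 * (\<tau>2 - \<tau>1) = R\<^sup>2 + 2 * (\<epsilon> * R\<^sup>2) + 1"
    using \<epsilon> assms by (auto intro!: divide_nonneg_pos add_nonneg_nonneg)
  with bound[of \<tau>2] show False by simp
qed

lemma r_tendsto_0: "(r \<longlongrightarrow> 0) at_top"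
proof (rule order_tendstoI)
  fix c :: real assume "0 < c"
  then obtain \<tau>1 where "\<tau>1 > \<tau>0" "r \<tau>1 < c"
    using r_arbitrarily_small by blast
  then show "\<forall>\<^sub>F \<tau> in at_top. r \<tau> < c"
    using r_antimono by (intro eventually_at_top_linorderI[of \<tau>1]) force
next
  fix c :: real assume "c < 0"
  then show "\<forall>\<^sub>F \<tau> in at_top. c < r \<tau>"
    by (simp add: less_le_trans[OF _ r_nonneg])
qed

lemma \<phi>_tendsto_0: "(\<phi> \<longlongrightarrow> 0) at_top" and z_tendsto_0: "(z \<longlongrightarrow> 0) at_top"
  by (rule Lim_null_comparison[OF _ r_tendsto_0], simp add: abs_\<phi>_le abs_z_le)+

section \<open>Averaged decay of the distance against the scale factor\<close>

text \<open>If \<open>r\<close> ever vanishes, monotonicity keeps it zero afterwards and both sides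
  are 0 from then on. Otherwise \<open>r\<close> is positive throughout and the square root can be
  differentiated.\<close>

lemma eventually_deriv_r:
  obtains \<tau>1 where "\<tau>1 \<ge> \<tau>0"
    and "\<And>\<tau>. \<tau> > \<tau>1 \<Longrightarrow> (r has_real_derivative - 3 * \<kappa> * (z \<tau>)\<^sup>2) (at \<tau>)"
proof (cases "\<exists>\<tau>1>\<tau>0. r \<tau>1 = 0")
  case True
  then obtain \<tau>1 where \<tau>1: "\<tau>1 > \<tau>0" "r \<tau>1 = 0" by blast
  then have r0: "r \<tau> = 0" if "\<tau> > \<tau>1" for \<tau>
    using r_antimono[of \<tau>1 \<tau>] r_nonneg[of \<tau>] that by simp
  have "(r has_real_derivative - 3 * \<kappa> * (z \<tau>)\<^sup>2) (at \<tau>)" if "\<tau> > \<tau>1" for \<tau>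
  proof -
    have "((\<lambda>_. 0) has_real_derivative 0) (at \<tau>)"
      by simp
    then have "(r has_real_derivative 0) (at \<tau>)"
      by (rule has_field_derivative_transform_within_open[where S = "{\<tau>1<..}"])
        (use that r0 in auto)
    moreover have "z \<tau> = 0"
      using abs_z_le[of \<tau>] r0[OF that] by simp
    ultimately show ?thesis by simp
  qed
  with \<tau>1 show ?thesis by (intro that[of \<tau>1]) auto
next
  case False
  have "(r has_real_derivative - 3 * \<kappa> * (z \<tau>)\<^sup>2) (at \<tau>)" if "\<tau> > \<tau>0" for \<tau>
  proof -
    have pos: "r \<tau> > 0"
      using False that r_nonneg[of \<tau>] by (metis less_le)
    have "((\<lambda>\<tau>. sqrt ((r \<tau>)\<^sup>2)) has_real_derivative
        inverse (sqrt ((r \<tau>)\<^sup>2)) / 2 * (- 6 * \<kappa> * r \<tau> * (z \<tau>)\<^sup>2)) (at \<tau>)"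
      by (rule DERIV_chain2[OF DERIV_real_sqrt deriv_r_power2[OF that]]) (use pos in simp)
    then show ?thesis
      using pos by (simp add: field_simps)
  qed
  then show ?thesis by (intro that[of \<tau>0]) auto
qed

text \<open>
  Without the cross term, \<open>b\<^sup>5 r\<^sup>4\<close> would decrease only on average over an oscillation; \<open>q\<close> is the energy
  with its oscillating part removed to first order. The exponent 5 lies strictly between 4, which
  is what the conclusion needs for unbounded \<open>b\<close>, and 6, for which \<open>b\<^sup>6 r\<^sup>4\<close> is stationary to
  leading order.
\<close>

lemma scale_factor_mult_r_tendsto_0:
  assumes b_pos: "\<And>\<tau>. \<tau> > \<tau>0 \<Longrightarrow> b \<tau> > 0"
    and deriv_b: "\<And>\<tau>. \<tau> > \<tau>0 \<Longrightarrow> (b has_real_derivative \<kappa> * r \<tau> * b \<tau>) (at \<tau>)"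
  shows "((\<lambda>\<tau>. b \<tau> * r \<tau>) \<longlongrightarrow> 0) at_top"
proof -
  obtain \<tau>1 where \<tau>1: "\<tau>1 \<ge> \<tau>0"
    and deriv_r: "\<And>\<tau>. \<tau> > \<tau>1 \<Longrightarrow> (r has_real_derivative - 3 * \<kappa> * (z \<tau>)\<^sup>2) (at \<tau>)"
    using eventually_deriv_r by blast
  \<comment> \<open>The threshold serves two estimates: \<open>\<kappa> * r \<le> 1 / 3\<close>
    gives \<open>q \<ge> r^2 / 2\<close>, and \<open>21 / 2 * (\<kappa> * r) \<le> 1\<close> lets
    the leading term in \<open>key\<close> dominate.\<close>
  have "eventually (\<lambda>\<tau>. r \<tau> < 1 / (12 * \<kappa>)) at_top"
    using \<kappa>_pos by (intro order_tendstoD(2)[OF r_tendsto_0]) simp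
  then obtain \<tau>2 where \<tau>2: "\<And>\<tau>. \<tau> \<ge> \<tau>2 \<Longrightarrow> r \<tau> < 1 / (12 * \<kappa>)"
    by (auto simp: eventually_at_top_linorder)
  define \<tau>3 where "\<tau>3 = max (\<tau>1 + 1) \<tau>2"
  have \<tau>3: "\<tau> > \<tau>1" "\<tau> > \<tau>0" "\<kappa> * r \<tau> \<le> 1 / 12" if "\<tau> \<ge> \<tau>3" for \<tau>
    using \<tau>1 \<tau>2[of \<tau>] that \<kappa>_pos by (auto simp: \<tau>3_def field_simps)
  \<comment> \<open>With coefficient \<open>3 * \<kappa>\<close> the leading part of the derivative,
    \<open>- 6 * \<kappa> * r * z^2 + 3 * \<kappa> * r * (z^2 - \<phi>^2)\<close>, collapses to
    \<open>- 3 * \<kappa> * r^3\<close>, which has no oscillating factor.\<close>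
  define q where "q \<tau> = (r \<tau>)\<^sup>2 + 3 * \<kappa> * (r \<tau> * (\<phi> \<tau> * z \<tau>))" for \<tau>
  define q' where "q' \<tau> = - 6 * \<kappa> * r \<tau> * (z \<tau>)\<^sup>2 + 3 * \<kappa> * (- 3 * \<kappa> * (z \<tau>)\<^sup>2 * (\<phi> \<tau> * z \<tau>)
      + r \<tau> * ((z \<tau>)\<^sup>2 - (\<phi> \<tau>)\<^sup>2 - 3 * \<kappa> * r \<tau> * (\<phi> \<tau> * z \<tau>)))" for \<tau>
  have deriv_q: "(q has_real_derivative q' \<tau>) (at \<tau>)" if "\<tau> \<ge> \<tau>3" for \<tau>
    unfolding q_def q'_def
    by (auto intro!: derivative_eq_intros deriv_\<phi> deriv_z' deriv_r_power2 deriv_r \<tau>3 that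
        simp: algebra_simps power2_eq_square)
  have q_ge: "(r \<tau>)\<^sup>2 / 2 \<le> q \<tau>" if "\<tau> \<ge> \<tau>3" for \<tau>
  proof -
    have "\<bar>\<kappa> * r \<tau> * (\<phi> \<tau> * z \<tau>)\<bar> \<le> 1 / 12 * ((r \<tau>)\<^sup>2 / 2)"
      unfolding abs_mult[of "\<kappa> * r \<tau>"]
      using \<tau>3[OF that] abs_\<phi>_mult_z_le[of \<tau>] \<kappa>_pos by (intro mult_mono) auto
    then show ?thesis
      using zero_le_power2[of "r \<tau>"] by (simp add: q_def mult.assoc abs_le_iff)
  qed
  \<comment> \<open>This factor decides the sign of the derivative of \<open>b^5 * q^2\<close>. Its
    leading part is \<open>(5 - 6) * \<kappa> * r^3\<close>; all other terms are of fourth order in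
    \<open>r\<close>.\<close>
  have key: "5 * \<kappa> * r \<tau> * q \<tau> + 2 * q' \<tau> \<le> 0" if "\<tau> \<ge> \<tau>3" for \<tau>
  proof -
    have "5 * \<kappa> * r \<tau> * q \<tau> + 2 * q' \<tau>
        = - \<kappa> * r \<tau> * (r \<tau>)\<^sup>2
          - \<kappa>\<^sup>2 * (3 * (r \<tau>)\<^sup>2 + 18 * (z \<tau>)\<^sup>2) * (\<phi> \<tau> * z \<tau>)"
      using r_power2[of \<tau>] unfolding q_def q'_def by algebra
    also have "\<dots> \<le> - \<kappa> * r \<tau> * (r \<tau>)\<^sup>2 + \<kappa>\<^sup>2 * (21 * (r \<tau>)\<^sup>2) * ((r \<tau>)\<^sup>2 / 2)"
    proof -
      have "3 * (r \<tau>)\<^sup>2 + 18 * (z \<tau>)\<^sup>2 \<le> 21 * (r \<tau>)\<^sup>2"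
        by (simp add: r_power2)
      then have "\<bar>\<kappa>\<^sup>2 * (3 * (r \<tau>)\<^sup>2 + 18 * (z \<tau>)\<^sup>2) * (\<phi> \<tau> * z \<tau>)\<bar>
          \<le> \<kappa>\<^sup>2 * (21 * (r \<tau>)\<^sup>2) * ((r \<tau>)\<^sup>2 / 2)"
        unfolding abs_mult[of "\<kappa>\<^sup>2 * (3 * (r \<tau>)\<^sup>2 + 18 * (z \<tau>)\<^sup>2)"]
        by (intro mult_mono[OF _ abs_\<phi>_mult_z_le]) (simp_all add: mult_left_mono)
      then show ?thesis by (simp add: abs_le_iff)
    qed
    also have "\<dots> = \<kappa> * r \<tau> * (r \<tau>)\<^sup>2 * (21 / 2 * (\<kappa> * r \<tau>) - 1)"
      by (simp add: algebra_simps power2_eq_square)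
    also have "\<dots> \<le> 0"
      using \<tau>3[OF that] \<kappa>_pos by (intro mult_nonneg_nonpos) auto
    finally show ?thesis .
  qed
  define Y where "Y \<tau> = (b \<tau>) ^ 5 * (q \<tau>)\<^sup>2" for \<tau>
  have Y_le: "Y \<tau> \<le> Y \<tau>3" if "\<tau> \<ge> \<tau>3" for \<tau>
  proof (rule DERIV_nonpos_imp_nonincreasing[OF that])
    fix x assume x: "\<tau>3 \<le> x"
    have "(Y has_real_derivative (b x) ^ 5 * q x * (5 * \<kappa> * r x * q x + 2 * q' x)) (at x)"
      unfolding Y_def
      by (auto intro!: derivative_eq_intros deriv_b deriv_q \<tau>3 x
          simp: algebra_simps power2_eq_square power_def eval_nat_numeral)
    moreover have "(b x) ^ 5 * q x * (5 * \<kappa> * r x * q x + 2 * q' x) \<le> 0"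
      using b_pos[OF \<tau>3(2)[OF x]] order_trans[OF _ q_ge[OF x]] key[OF x]
      by (intro mult_nonneg_nonpos mult_nonneg_nonneg) auto
    ultimately show "\<exists>y. (Y has_real_derivative y) (at x) \<and> y \<le> 0" by blast
  qed
  \<comment> \<open>The 4 comes from squaring \<open>q \<ge> r^2 / 2\<close>.\<close>
  define C where "C = 4 * Y \<tau>3"
  have C: "(b \<tau>) ^ 5 * (r \<tau>) ^ 4 \<le> C" if "\<tau> \<ge> \<tau>3" for \<tau>
  proof -
    have "((r \<tau>)\<^sup>2 / 2)\<^sup>2 \<le> (q \<tau>)\<^sup>2"
      using q_ge[OF that] by (intro power_mono) auto
    then have "(b \<tau>) ^ 5 * ((r \<tau>)\<^sup>2 / 2)\<^sup>2 \<le> Y \<tau>"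
      unfolding Y_def using b_pos[OF \<tau>3(2)[OF that]] by (intro mult_left_mono) auto
    then show ?thesis
      using Y_le[OF that] by (simp add: C_def power_divide)
  qed
  have C_nonneg: "C \<ge> 0"
    using b_pos[OF \<tau>3(2)[of \<tau>3]] by (simp add: C_def Y_def)
  have "((\<lambda>\<tau>. (b \<tau> * r \<tau>) ^ 4) \<longlongrightarrow> 0) at_top"
  proof (rule order_tendstoI)
    fix e :: real assume e: "e > 0"
    \<comment> \<open>A threshold for \<open>b\<close>: below \<open>B\<close> the decay of
      \<open>r\<close> suffices, and above \<open>B\<close> one has
      \<open>(b * r)^4 = b^5 * r^4 / b \<le> C / B < e\<close>. Thus neither boundedness nor
      divergence of \<open>b\<close> has to be known.\<close>
    define B where "B = (C + 1) / e"
    have B: "B > 0" "C < e * B"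
      using e C_nonneg by (auto simp: B_def)
    have "((\<lambda>\<tau>. B ^ 4 * (r \<tau>) ^ 4) \<longlongrightarrow> B ^ 4 * 0 ^ 4) at_top"
      by (intro tendsto_intros r_tendsto_0)
    then have "\<forall>\<^sub>F \<tau> in at_top. B ^ 4 * (r \<tau>) ^ 4 < e"
      using e by (intro order_tendstoD) auto
    then show "\<forall>\<^sub>F \<tau> in at_top. (b \<tau> * r \<tau>) ^ 4 < e"
      using eventually_ge_at_top[of \<tau>3]
    proof eventually_elim
      case (elim \<tau>)
      have b: "b \<tau> > 0" using b_pos \<tau>3(2) elim by blast
      show ?case
      proof (cases "b \<tau> \<le> B")
        case True
        then have "(b \<tau> * r \<tau>) ^ 4 \<le> B ^ 4 * (r \<tau>) ^ 4"
          unfolding power_mult_distrib using b by (intro mult_right_mono power_mono) auto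
        with elim show ?thesis by simp
      next
        case False
        then have "B * (b \<tau> * r \<tau>) ^ 4 \<le> b \<tau> * (b \<tau> * r \<tau>) ^ 4"
          by (intro mult_right_mono) auto
        also have "\<dots> = (b \<tau>) ^ 5 * (r \<tau>) ^ 4"
          by (simp add: power_mult_distrib eval_nat_numeral)
        also have "\<dots> < e * B"
          using C[of \<tau>] elim B by simp
        finally show ?thesis
          using B by (simp add: mult.commute)
      qed
    qed
  next
    fix e :: real assume "e < 0"
    then show "\<forall>\<^sub>F \<tau> in at_top. e < (b \<tau> * r \<tau>) ^ 4"
      by (simp add: less_le_trans[OF _ zero_le_even_power])
  qed
  then have "((\<lambda>\<tau>. root 4 ((b \<tau> * r \<tau>) ^ 4)) \<longlongrightarrow> root 4 0) at_top"
    by (intro tendsto_real_root)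
  moreover have "\<forall>\<^sub>F \<tau> in at_top. root 4 ((b \<tau> * r \<tau>) ^ 4) = b \<tau> * r \<tau>"
    using eventually_gt_at_top[of \<tau>0]
    by eventually_elim (simp add: real_root_power_cancel less_imp_le[OF b_pos])
  ultimately show ?thesis
    by (simp add: filterlim_cong)
qed

end


section \<open>Scale factors with vanishing expansion rate\<close>

lemma uniform_limit_translate:
  fixes f :: "real \<Rightarrow> 'a::metric_space"
  assumes "(f \<longlongrightarrow> l) at_top"
  shows "uniform_limit {-L..L} (\<lambda>T s. f (T + s)) (\<lambda>_. l) at_top"
proof (rule uniform_limitI)
  fix e :: real assume "e > 0"
  then obtain N where N: "\<And>t. t \<ge> N \<Longrightarrow> dist (f t) l < e"
    using tendstoD[OF assms] by (auto simp: eventually_at_top_linorder)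
  show "\<forall>\<^sub>F T in at_top. \<forall>s\<in>{-L..L}. dist (f (T + s)) l < e"
    using eventually_ge_at_top[of "N + L"] by eventually_elim (auto intro!: N)
qed

text \<open>The derivative of \<open>ln a\<close> is \<open>H\<close>, so by the mean value
  inequality \<open>ln a\<close> changes over a window of half-width \<open>L\<close> by at most
  \<open>L\<close> times a bound of \<open>\<bar>H\<bar>\<close> there. For negative
  \<open>L\<close> the window is empty.\<close>

lemma uniform_limit_ln_ratio:
  fixes a H :: "real \<Rightarrow> real"
  assumes a_pos: "\<And>t. t > t1 \<Longrightarrow> a t > 0"
    and deriv_a: "\<And>t. t > t1 \<Longrightarrow> (a has_real_derivative H t * a t) (at t)"
    and H: "(H \<longlongrightarrow> 0) at_top"
  shows "uniform_limit {-L..L} (\<lambda>T s. ln (a (T + s)) - ln (a T)) (\<lambda>_. 0) at_top"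
proof (cases "L \<ge> 0")
  case True
  show ?thesis
  proof (rule uniform_limitI)
    fix e :: real assume e: "e > 0"
    \<comment> \<open>The summand 1 covers \<open>L = 0\<close> and makes \<open>B * L < e\<close>
      strict.\<close>
    define B where "B = e / (L + 1)"
    have B: "B > 0" "B * L < e"
      using e True by (auto simp: B_def field_simps)
    obtain N where N: "\<And>t. t \<ge> N \<Longrightarrow> \<bar>H t\<bar> < B"
      using tendstoD[OF H B(1)] by (auto simp: eventually_at_top_linorder)
    show "\<forall>\<^sub>F T in at_top. \<forall>s\<in>{-L..L}. dist (ln (a (T + s)) - ln (a T)) 0 < e"
      using eventually_gt_at_top[of "max N t1 + L"]
    proof eventually_elim
      case (elim T)
      show ?case
      proof
        fix s assume s: "s \<in> {-L..L}"
        have "norm (ln (a (T + s)) - ln (a T)) \<le> B * norm ((T + s) - T)"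
        proof (rule field_differentiable_bound)
          fix x assume "x \<in> {T - L..T + L}"
          then have x: "x > t1" "x \<ge> N"
            using elim by auto
          have "((\<lambda>x. ln (a x)) has_real_derivative H x) (at x)"
            using a_pos[OF x(1)] by (auto intro!: derivative_eq_intros deriv_a x)
          then show "((\<lambda>x. ln (a x)) has_real_derivative H x) (at x within {T - L..T + L})"
            by (rule has_field_derivative_at_within)
          show "norm (H x) \<le> B"
            using N[OF x(2)] by simp
        qed (use s in auto)
        also have "\<dots> \<le> B * L"
          using s B by (intro mult_left_mono) auto
        finally show "dist (ln (a (T + s)) - ln (a T)) 0 < e"
          using B by simp
      qed
    qed
  qed
qed (simp add: uniform_limit_iff)

text \<open>The squared ratio is the exponential of twice the difference of logarithms, so
  continuity of \<open>exp\<close> at 0 carries the uniform limit over. The two expressions are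
  identified only for late \<open>T\<close>, where \<open>a\<close> is positive on the
  window.\<close>

lemma uniform_limit_ratio_power2:
  fixes a H :: "real \<Rightarrow> real"
  assumes a_pos: "\<And>t. t > t1 \<Longrightarrow> a t > 0"
    and deriv_a: "\<And>t. t > t1 \<Longrightarrow> (a has_real_derivative H t * a t) (at t)"
    and H: "(H \<longlongrightarrow> 0) at_top"
  shows "uniform_limit {-L..L} (\<lambda>T s. (a (T + s) / a T)\<^sup>2) (\<lambda>_. 1) at_top"
proof -
  have "uniform_limit {-L..L} (\<lambda>T s. exp (2 * (ln (a (T + s)) - ln (a T)))) (\<lambda>_. 1) at_top"
  proof (rule uniform_limitI)
    fix e :: real assume "e > 0"
    moreover have "isCont (\<lambda>x::real. exp (2 * x)) 0"
      by (intro continuous_intros)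
    ultimately obtain d where d: "d > 0" "\<And>x::real. dist x 0 < d \<Longrightarrow> dist (exp (2 * x)) 1 < e"
      unfolding continuous_at_eps_delta by auto
    have "uniform_limit {-L..L} (\<lambda>T s. ln (a (T + s)) - ln (a T)) (\<lambda>_. 0) at_top"
      using assms by (rule uniform_limit_ln_ratio)
    from uniform_limitD[OF this d(1)]
    show "\<forall>\<^sub>F T in at_top. \<forall>s\<in>{-L..L}. dist (exp (2 * (ln (a (T + s)) - ln (a T)))) 1 < e"
      by eventually_elim (use d(2) in blast)
  qed
  moreover have "\<forall>\<^sub>F T in at_top. \<forall>s\<in>{-L..L}.
      exp (2 * (ln (a (T + s)) - ln (a T))) = (a (T + s) / a T)\<^sup>2"
    using eventually_gt_at_top[of "t1 + \<bar>L\<bar>"]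
  proof eventually_elim
    case (elim T)
    show ?case
    proof
      fix s assume "s \<in> {-L..L}"
      then have "a (T + s) > 0" "a T > 0"
        using elim by (auto intro!: a_pos)
      then show "exp (2 * (ln (a (T + s)) - ln (a T))) = (a (T + s) / a T)\<^sup>2"
        by (simp add: exp_double exp_diff power_divide)
    qed
  qed
  ultimately show ?thesis
    by (subst (asm) uniform_limit_cong) auto
qed

section \<open>Convergence of the metric in epoch coordinates\<close>

text \<open>The chart is affine, so its derivative is its linear part, whose spatial factor enters
  the metric squared. For \<open>a T = 0\<close> both sides lose the spatial term, since
  \<open>inverse 0 = 0\<close>.\<close>

lemma pullback_epoch_chart_friedmann_metric:
  "pullback_metric (epoch_chart a T) (friedmann_metric a) (s, y) u v
     = fst u * fst v - (a (T + s) / a T)\<^sup>2 * (snd u \<bullet> snd v)"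
proof -
  have "(epoch_chart a T has_derivative (\<lambda>h. (fst h, snd h /\<^sub>R a T))) (at (s, y))"
    unfolding epoch_chart_def[abs_def] by (auto intro!: derivative_eq_intros)
  then have "frechet_derivative (epoch_chart a T) (at (s, y)) = (\<lambda>h. (fst h, snd h /\<^sub>R a T))"
    by (rule frechet_derivative_at[symmetric])
  then show ?thesis
    by (simp add: pullback_metric_def friedmann_metric_def epoch_chart_def
        power2_eq_square divide_inverse)
qed

text \<open>The only varying coefficient is \<open>Q = (a (T + s) / a T)^2\<close>, with derivatives
  \<open>2 * H * Q\<close> and \<open>(2 * G + 4 * H^2) * Q\<close>. As \<open>Q\<close> tends to 1
  and \<open>H\<close>, \<open>G\<close> to 0, the metric tends to Minkowski and both derivatives to
  0.\<close>

lemma asymptotically_minkowskiI: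
  fixes a H G :: "real \<Rightarrow> real"
  assumes a_pos: "\<And>t. t > t1 \<Longrightarrow> a t > 0"
    and deriv_a: "\<And>t. t > t1 \<Longrightarrow> (a has_real_derivative H t * a t) (at t)"
    and deriv_H: "\<And>t. t > t1 \<Longrightarrow> (H has_real_derivative G t) (at t)"
    and H: "(H \<longlongrightarrow> 0) at_top" and G: "(G \<longlongrightarrow> 0) at_top"
  shows "asymptotically_minkowski a"
proof -
  have "uniform_limit {-L..L}
        (\<lambda>T. (deriv ^^ k) (\<lambda>s. pullback_metric (epoch_chart a T) (friedmann_metric a) (s, y) u v))
        ((deriv ^^ k) (\<lambda>s. minkowski_metric (s, y) u v)) at_top"
    if "k \<le> 2" for k :: nat and y u v L
  proof -
    define c w where "c = fst u * fst v" and "w = snd u \<bullet> snd v"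
    define Q where "Q T s = (a (T + s) / a T)\<^sup>2" for T s
    define g where "g T s = c - Q T s * w" for T s
    define g1 where "g1 T s = - (2 * H (T + s) * Q T s * w)" for T s
    define g2 where "g2 T s = - ((2 * G (T + s) + 4 * (H (T + s))\<^sup>2) * Q T s * w)" for T s
    have Q: "uniform_limit {-L..L} Q (\<lambda>_. 1) at_top"
      unfolding Q_def[abs_def] using a_pos deriv_a H by (rule uniform_limit_ratio_power2)
    have UH: "uniform_limit {-L..L} (\<lambda>T s. 2 * H (T + s)) (\<lambda>_. 0) at_top"
      by (rule uniform_limit_translate) (auto intro!: tendsto_eq_intros H)
    have UG: "uniform_limit {-L..L} (\<lambda>T s. 2 * G (T + s) + 4 * (H (T + s))\<^sup>2) (\<lambda>_. 0) at_top"
      by (rule uniform_limit_translate[of "\<lambda>t. 2 * G t + 4 * (H t)\<^sup>2"])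
        (auto intro!: tendsto_eq_intros H G)
    \<comment> \<open>The limits are constant, hence bounded on the window, as multiplication of
      uniform limits requires.\<close>
    have Uw: "uniform_limit {-L..L} (\<lambda>T s. f T s * Q T s * w) (\<lambda>_. l * 1 * w) at_top"
      if "uniform_limit {-L..L} f (\<lambda>_. l) at_top" for f and l :: real
      by (intro uniform_lim_mult that Q uniform_limit_const) (auto simp: image_constant_conv)
    have U0: "uniform_limit {-L..L} g (\<lambda>_. c - 1 * 1 * w) at_top"
      using uniform_limit_minus[OF uniform_limit_const[where c = "\<lambda>_. c"]
          Uw[OF uniform_limit_const[where c = "\<lambda>_. 1"]]]
      by (simp add: g_def[abs_def])
    have U1: "uniform_limit {-L..L} g1 (\<lambda>_. - (0 * 1 * w)) at_top"
      using uniform_limit_uminus[OF Uw[OF UH]] by (simp add: g1_def[abs_def])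
    have U2: "uniform_limit {-L..L} g2 (\<lambda>_. - (0 * 1 * w)) at_top"
      using uniform_limit_uminus[OF Uw[OF UG]] by (simp add: g2_def[abs_def])
    have dQ: "(Q T has_real_derivative 2 * H (T + s) * Q T s) (at s)" if "T + s > t1" for T s
    proof -
      have "((\<lambda>s. a (T + s)) has_real_derivative H (T + s) * a (T + s)) (at s)"
        using DERIV_shift[of a "H (T + s) * a (T + s)" s T] deriv_a[OF that]
        by (simp add: add.commute)
      then have "((\<lambda>s. (a (T + s))\<^sup>2) has_real_derivative 2 * H (T + s) * (a (T + s))\<^sup>2) (at s)"
        by (auto intro!: derivative_eq_intros simp: power2_eq_square)
      from DERIV_cdivide[OF this, of "(a T)\<^sup>2"] show ?thesis
        by (simp add: Q_def[abs_def] power_divide)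
    qed
    have dg: "(g T has_real_derivative g1 T s) (at s)" if "T + s > t1" for T s
      unfolding g_def g1_def by (auto intro!: derivative_eq_intros dQ that)
    have dg1: "(g1 T has_real_derivative g2 T s) (at s)" if "T + s > t1" for T s
    proof -
      have "((\<lambda>s. H (T + s)) has_real_derivative G (T + s)) (at s)"
        using DERIV_shift[of H "G (T + s)" s T] deriv_H[OF that] by (simp add: add.commute)
      then show ?thesis
        unfolding g1_def g2_def
        by (auto intro!: derivative_eq_intros dQ that simp: algebra_simps power2_eq_square)
    qed
    have deriv_g: "deriv (g T) s = g1 T s" if "T + s > t1" for T s
      using dg[OF that] by (rule DERIV_imp_deriv)
    have deriv_deriv_g: "deriv (deriv (g T)) s = g2 T s" if "T + s > t1" for T s
    proof -
      \<comment> \<open>A second derivative needs the formula for the first one on a whole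
        neighbourhood of \<open>s\<close>.\<close>
      have "\<forall>\<^sub>F x in nhds s. x \<in> {t1 - T<..}"
        using that by (intro eventually_nhds_in_open) auto
      then have "\<forall>\<^sub>F x in nhds s. deriv (g T) x = g1 T x"
        by eventually_elim (simp add: deriv_g)
      then have "deriv (deriv (g T)) s = deriv (g1 T) s"
        by (intro deriv_cong_ev) auto
      with DERIV_imp_deriv[OF dg1[OF that]] show ?thesis by simp
    qed
    have ev: "\<forall>\<^sub>F T in at_top. \<forall>s\<in>{-L..L}. T + s > t1"
      using eventually_gt_at_top[of "t1 + L"] by eventually_elim auto
    have U1': "uniform_limit {-L..L} (\<lambda>T. deriv (g T)) (\<lambda>_. 0) at_top"
      using U1 by (rule uniform_limit_cong[THEN iffD1, rotated 2])
        (auto intro: eventually_mono[OF ev] simp: deriv_g)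
    have U2': "uniform_limit {-L..L} (\<lambda>T. deriv (deriv (g T))) (\<lambda>_. 0) at_top"
      using U2 by (rule uniform_limit_cong[THEN iffD1, rotated 2])
        (auto intro: eventually_mono[OF ev] simp: deriv_deriv_g)
    have pull: "(\<lambda>s. pullback_metric (epoch_chart a T) (friedmann_metric a) (s, y) u v) = g T" for T
      by (simp add: fun_eq_iff pullback_epoch_chart_friedmann_metric g_def Q_def c_def w_def)
    have mink: "(\<lambda>s. minkowski_metric (s, y) u v) = (\<lambda>_. c - w)"
      by (simp add: minkowski_metric_def c_def w_def)
    consider "k = 0" | "k = 1" | "k = 2"
      using \<open>k \<le> 2\<close> by linarith
    then show ?thesis
      unfolding pull mink using U0 U1' U2' by cases (simp_all add: numeral_2_eq_2)
  qed
  then show ?thesis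
    by (simp add: asymptotically_minkowski_def)
qed

section \<open>Exclusion of constant inflation\<close>

text \<open>A positive limit of \<open>hubble a\<close> contradicts uniqueness of limits. If
  \<open>a\<close> were asymptotic to \<open>C * exp (H0 * t)\<close>, then
  \<open>a (t + 1) / a t\<close> would tend to \<open>exp H0 > 1\<close>, whereas vanishing
  \<open>H\<close> forces the limit of its square to be 1.\<close>

lemma not_comes_to_constant_inflationI:
  fixes a H :: "real \<Rightarrow> real"
  assumes a_pos: "\<And>t. t > t1 \<Longrightarrow> a t > 0"
    and deriv_a: "\<And>t. t > t1 \<Longrightarrow> (a has_real_derivative H t * a t) (at t)"
    and H: "(H \<longlongrightarrow> 0) at_top"
  shows "\<not> comes_to_constant_inflation a"
proof
  assume "comes_to_constant_inflation a"
  then obtain H0 where H0: "H0 > 0"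
    and "(hubble a \<longlongrightarrow> H0) at_top \<or> (\<exists>C>0. ((\<lambda>t. a t / exp (H0 * t)) \<longlongrightarrow> C) at_top)"
    by (auto simp: comes_to_constant_inflation_def)
  then consider "(hubble a \<longlongrightarrow> H0) at_top"
    | C where "C > 0" "((\<lambda>t. a t / exp (H0 * t)) \<longlongrightarrow> C) at_top"
    by blast
  then show False
  proof cases
    case 1
    have "\<forall>\<^sub>F t in at_top. hubble a t = H t"
      using eventually_gt_at_top[of t1]
    proof eventually_elim
      case (elim t)
      then show ?case
        using a_pos[of t] DERIV_imp_deriv[OF deriv_a[of t]] by (simp add: hubble_def)
    qed
    with 1 have "(H \<longlongrightarrow> H0) at_top"
      by (rule Lim_transform_eventually)
    with H H0 show False
      using tendsto_unique[OF trivial_limit_at_top_linorder] by fastforce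
  next
    case 2
    define f where "f t = a t / exp (H0 * t)" for t
    have f: "(f \<longlongrightarrow> C) at_top"
      using 2 by (simp add: f_def[abs_def])
    have "((\<lambda>t. f (t + 1)) \<longlongrightarrow> C) at_top"
      using filterlim_compose[OF f filterlim_tendsto_add_at_top[OF tendsto_const[of 1] filterlim_ident]]
      by (simp add: add.commute)
    \<comment> \<open>Squares appear to match \<open>uniform_limit_ratio_power2\<close>, which is
      evaluated below at \<open>s = 1\<close>.\<close>
    then have lim: "((\<lambda>t. (f (t + 1) / f t)\<^sup>2) \<longlongrightarrow> (C / C)\<^sup>2) at_top"
      using f 2 by (intro tendsto_intros) auto
    have "((\<lambda>t. (a (t + 1) / a t)\<^sup>2 / (exp H0)\<^sup>2) \<longlongrightarrow> 1 / (exp H0)\<^sup>2) at_top"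
    proof (intro tendsto_divide tendsto_const)
      have "uniform_limit {-1..1} (\<lambda>T s. (a (T + s) / a T)\<^sup>2) (\<lambda>_. 1) at_top"
        using assms by (rule uniform_limit_ratio_power2)
      then show "((\<lambda>t. (a (t + 1) / a t)\<^sup>2) \<longlongrightarrow> 1) at_top"
        by (rule tendsto_uniform_limitI) simp
    qed simp
    moreover have "(a (t + 1) / a t)\<^sup>2 / (exp H0)\<^sup>2 = (f (t + 1) / f t)\<^sup>2" for t
      by (simp add: f_def exp_add distrib_left power_divide field_simps power_mult_distrib)
    ultimately have "((\<lambda>t. (f (t + 1) / f t)\<^sup>2) \<longlongrightarrow> 1 / (exp H0)\<^sup>2) at_top"
      by simp
    with lim have "(C / C)\<^sup>2 = 1 / (exp H0)\<^sup>2"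
      by (rule tendsto_unique[OF trivial_limit_at_top_linorder])
    moreover have "(exp H0)\<^sup>2 > 1"
      using H0 by (intro one_less_power) auto
    ultimately show False
      using 2 by simp
  qed
qed


section \<open>The phase plane\<close>

lemma has_vector_derivative_componentwise:
  fixes x :: "real \<Rightarrow> real ^ 'n"
  shows "(x has_vector_derivative d) (at t within S) \<longleftrightarrow>
    (\<forall>i. ((\<lambda>t. x t $ i) has_real_derivative d $ i) (at t within S))"
  unfolding has_vector_derivative_def has_derivative_componentwise_within[of x]
  by (simp add: Basis_vec_def inner_axis has_field_derivative_def mult_commute_abs)

lemma sqrt_24_pi: "sqrt (24 * pi) = 3 * sqrt (8 * pi / 3)"
  by (rule real_sqrt_unique) (simp_all add: power_mult_distrib)

lemma solves_from_phase_field_iff: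
  "solves_from phase_field \<tau>0 x \<longleftrightarrow>
    (\<forall>\<tau>>\<tau>0. ((\<lambda>\<tau>. x \<tau> $ 1) has_real_derivative x \<tau> $ 2) (at \<tau>) \<and>
      ((\<lambda>\<tau>. x \<tau> $ 2) has_real_derivative
        - (3 * sqrt (8 * pi / 3) * sqrt ((x \<tau> $ 2)\<^sup>2 + (x \<tau> $ 1)\<^sup>2) * x \<tau> $ 2) - x \<tau> $ 1) (at \<tau>))"
  by (simp add: solves_from_def has_vector_derivative_componentwise forall_2 phase_field_def sqrt_24_pi)

lemma solves_from_phase_field_imp_damped_oscillator:
  "solves_from phase_field \<tau>0 x \<Longrightarrow>
    damped_oscillator (sqrt (8 * pi / 3)) \<tau>0 (\<lambda>\<tau>. x \<tau> $ 1) (\<lambda>\<tau>. x \<tau> $ 2)"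
  by (simp add: solves_from_phase_field_iff damped_oscillator_def)

lemma solves_from_phase_field_tendsto:
  assumes "solves_from phase_field \<tau>0 x"
  shows "(x \<longlongrightarrow> vector [0, 0]) at_top"
proof -
  interpret damped_oscillator "sqrt (8 * pi / 3)" \<tau>0 "\<lambda>\<tau>. x \<tau> $ 1" "\<lambda>\<tau>. x \<tau> $ 2"
    using assms by (rule solves_from_phase_field_imp_damped_oscillator)
  have "((\<lambda>\<tau>. x \<tau> $ i) \<longlongrightarrow> vector [0, 0] $ i) at_top" for i
    using exhaust_2[of i] \<phi>_tendsto_0 z_tendsto_0 by auto
  then show ?thesis
    by (rule vec_tendstoI)
qed

section \<open>Passage between the times \<open>t\<close> and \<open>\<tau> = m * t\<close>\<close>

text \<open>An equivalence of derivative statements, so that differentiability itself passes in both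
  directions between the cosmological equations and the dynamic system.\<close>

lemma scaled_field_has_derivative_iff:
  assumes "m > 0"
  shows "(scaled_field m f has_real_derivative D) (at (m * t)) \<longleftrightarrow>
    (f has_real_derivative m * D) (at t)"
proof
  assume "(scaled_field m f has_real_derivative D) (at (m * t))"
  then have "((\<lambda>t. scaled_field m f (m * t)) has_real_derivative D * m) (at t)"
    by (rule DERIV_chain2) (auto intro!: derivative_eq_intros)
  then show "(f has_real_derivative m * D) (at t)"
    using assms by (simp add: scaled_field_def mult.commute)
next
  assume "(f has_real_derivative m * D) (at t)"
  then have "(f has_real_derivative m * D) (at (m * t / m))"
    using assms by simp
  then have "((\<lambda>\<tau>. f (\<tau> / m)) has_real_derivative m * D * (1 / m)) (at (m * t))"
    by (rule DERIV_chain2) (use assms in \<open>auto intro!: derivative_eq_intros\<close>)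
  then show "(scaled_field m f has_real_derivative D) (at (m * t))"
    using assms by (simp add: scaled_field_def[abs_def])
qed

lemma deriv_scaled_field:
  assumes "m > 0" "f differentiable (at t)"
  shows "deriv (scaled_field m f) (m * t) = deriv f t / m"
  using assms
  by (intro DERIV_imp_deriv) (simp add: scaled_field_has_derivative_iff DERIV_deriv_iff_real_differentiable)

lemma phase_curve_1: "m > 0 \<Longrightarrow> phase_curve m \<Phi> (m * t) $ 1 = \<Phi> t"
  by (simp add: phase_curve_def scaled_field_def)

lemma phase_curve_2:
  "m > 0 \<Longrightarrow> \<Phi> differentiable (at t) \<Longrightarrow> phase_curve m \<Phi> (m * t) $ 2 = deriv \<Phi> t / m"
  by (simp add: phase_curve_def deriv_scaled_field)

lemma solves_from_phase_curve_iff: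
  assumes m: "m > 0"
  shows "solves_from phase_field (m * t0) (phase_curve m \<Phi>) \<longleftrightarrow>
    (\<forall>t>t0. \<Phi> differentiable (at t) \<and> (deriv \<Phi> has_real_derivative
       - (3 * (m * sqrt (8 * pi / 3) * sqrt ((deriv \<Phi> t / m)\<^sup>2 + (\<Phi> t)\<^sup>2)) * deriv \<Phi> t) - m\<^sup>2 * \<Phi> t)
         (at t))"
    (is "_ \<longleftrightarrow> (\<forall>t>t0. _ \<and> (deriv \<Phi> has_real_derivative ?D t) (at t))")
proof -
  define x where "x = phase_curve m \<Phi>"
  define F where "F \<tau> = - (3 * sqrt (8 * pi / 3) * sqrt ((x \<tau> $ 2)\<^sup>2 + (x \<tau> $ 1)\<^sup>2) * x \<tau> $ 2) - x \<tau> $ 1"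
    for \<tau>
  have rescale: "(\<forall>\<tau>>m * t0. P \<tau>) \<longleftrightarrow> (\<forall>t>t0. P (m * t))" for P
  proof
    assume *: "\<forall>t>t0. P (m * t)"
    show "\<forall>\<tau>>m * t0. P \<tau>"
    proof (intro allI impI)
      fix \<tau> assume "\<tau> > m * t0"
      then show "P \<tau>" using *[rule_format, of "\<tau> / m"] m by (simp add: field_simps)
    qed
  qed (use m in simp)
  \<comment> \<open>The second component is by definition the derivative of the first, so the first
    equation says only that \<Phi> is differentiable.\<close>
  have 1: "((\<lambda>\<tau>. x \<tau> $ 1) has_real_derivative x (m * t) $ 2) (at (m * t)) \<longleftrightarrow> \<Phi> differentiable (at t)"
    for t
  proof -
    have *: "(\<lambda>\<tau>. x \<tau> $ 1) = scaled_field m \<Phi>"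
      by (simp add: x_def phase_curve_def)
    show ?thesis
      unfolding * scaled_field_has_derivative_iff[OF m]
    proof
      assume "\<Phi> differentiable (at t)"
      then show "(\<Phi> has_real_derivative m * x (m * t) $ 2) (at t)"
        using m by (simp add: x_def phase_curve_2 DERIV_deriv_iff_real_differentiable)
    qed (auto simp: real_differentiable_def)
  qed
  \<comment> \<open>\<open>phase_curve_2\<close> identifies the second component with
    \<open>deriv \<Phi> t / m\<close> only where \<Phi> is differentiable; differentiating it needs
    this near \<open>t\<close>, hence the assumption on the whole half-line.\<close>
  have 2: "((\<lambda>\<tau>. x \<tau> $ 2) has_real_derivative F (m * t)) (at (m * t)) \<longleftrightarrow>
      (deriv \<Phi> has_real_derivative ?D t) (at t)"
    if t: "t > t0" and diff: "\<And>t. t > t0 \<Longrightarrow> \<Phi> differentiable (at t)" for t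
  proof -
    have "x \<tau> $ 2 = scaled_field m (\<lambda>t. deriv \<Phi> t / m) \<tau>" if "\<tau> > m * t0" for \<tau>
      using phase_curve_2[OF m diff[of "\<tau> / m"]] that m
      by (simp add: x_def scaled_field_def field_simps)
    moreover have "\<forall>\<^sub>F \<tau> in nhds (m * t). \<tau> \<in> {m * t0<..}"
      using t m by (intro eventually_nhds_in_open) auto
    ultimately have "\<forall>\<^sub>F \<tau> in nhds (m * t). x \<tau> $ 2 = scaled_field m (\<lambda>t. deriv \<Phi> t / m) \<tau>"
      by (auto elim: eventually_mono)
    then have "((\<lambda>\<tau>. x \<tau> $ 2) has_real_derivative F (m * t)) (at (m * t)) \<longleftrightarrow>
        (scaled_field m (\<lambda>t. deriv \<Phi> t / m) has_real_derivative F (m * t)) (at (m * t))"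
      by (intro DERIV_cong_ev) auto
    also have "\<dots> \<longleftrightarrow> ((\<lambda>t. deriv \<Phi> t / m) has_real_derivative m * F (m * t)) (at t)"
      by (rule scaled_field_has_derivative_iff[OF m])
    also have "\<dots> \<longleftrightarrow> (deriv \<Phi> has_real_derivative m * (m * F (m * t))) (at t)"
    proof
      assume "((\<lambda>t. deriv \<Phi> t / m) has_real_derivative m * F (m * t)) (at t)"
      from DERIV_cmult[OF this, of m]
      show "(deriv \<Phi> has_real_derivative m * (m * F (m * t))) (at t)"
        using m by simp
    next
      assume "(deriv \<Phi> has_real_derivative m * (m * F (m * t))) (at t)"
      from DERIV_cdivide[OF this, of m]
      show "((\<lambda>t. deriv \<Phi> t / m) has_real_derivative m * F (m * t)) (at t)"
        using m by simp
    qed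
    also have "m * (m * F (m * t)) = ?D t"
      using m by (simp add: F_def x_def phase_curve_1 phase_curve_2 diff t field_simps power2_eq_square)
    finally show ?thesis .
  qed
  show ?thesis
    unfolding solves_from_phase_field_iff rescale x_def[symmetric] F_def[symmetric] 1
    using 2 by blast
qed

section \<open>Elimination of the scale factor by the Einstein equation\<close>

lemma hubble_branch_iff:
  fixes h p f m :: real
  assumes "m > 0"
  shows "h \<ge> 0 \<and> 3 * h\<^sup>2 = 8 * pi * (p\<^sup>2 + m\<^sup>2 * f\<^sup>2) \<longleftrightarrow>
    h = m * sqrt (8 * pi / 3) * sqrt ((p / m)\<^sup>2 + f\<^sup>2)" (is "_ \<longleftrightarrow> h = ?R")
proof -
  have "?R \<ge> 0" using assms by simp
  have "?R\<^sup>2 = m\<^sup>2 * (8 * pi / 3) * ((p / m)\<^sup>2 + f\<^sup>2)"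
    by (simp add: power_mult_distrib)
  also have "\<dots> = 8 * pi / 3 * (p\<^sup>2 + m\<^sup>2 * f\<^sup>2)"
    using assms by (simp add: field_simps)
  finally have "3 * ?R\<^sup>2 = 8 * pi * (p\<^sup>2 + m\<^sup>2 * f\<^sup>2)"
    by simp
  then have "3 * h\<^sup>2 = 8 * pi * (p\<^sup>2 + m\<^sup>2 * f\<^sup>2) \<longleftrightarrow> h\<^sup>2 = ?R\<^sup>2"
    by linarith
  with \<open>?R \<ge> 0\<close> show ?thesis
    by (metis power2_eq_iff_nonneg)
qed

text \<open>On the branch of nonnegative \<open>hubble a\<close> the Einstein equation gives
  \<open>hubble a\<close> as a function of the field and its derivative. Inserting it into the field
  equation removes \<open>a\<close> and leaves the autonomous system.\<close>

lemma friedmann_scalar_solution_iff: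
  assumes m: "m > 0"
  shows "friedmann_scalar_solution m t0 a \<Phi> \<longleftrightarrow>
        (\<forall>t>t0. a t > 0 \<and> a differentiable (at t) \<and>
           hubble a t = m * sqrt (8 * pi / 3) *
             sqrt ((phase_curve m \<Phi> (m * t) $ 2)\<^sup>2 + (phase_curve m \<Phi> (m * t) $ 1)\<^sup>2)) \<and>
        solves_from phase_field (m * t0) (phase_curve m \<Phi>)"
proof -
  define h where "h t = m * sqrt (8 * pi / 3) * sqrt ((deriv \<Phi> t / m)\<^sup>2 + (\<Phi> t)\<^sup>2)" for t
  have branch: "hubble a t \<ge> 0 \<and> 3 * (deriv a t)\<^sup>2 / (a t)\<^sup>2 = 8 * pi * ((deriv \<Phi> t)\<^sup>2 + m\<^sup>2 * (\<Phi> t)\<^sup>2)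
      \<longleftrightarrow> hubble a t = h t" for t
    using hubble_branch_iff[OF m, of "hubble a t" "deriv \<Phi> t" "\<Phi> t"]
    by (simp add: h_def hubble_def power_divide)
  \<comment> \<open>\<open>deriv\<close> is total, so the equation for
    \<open>deriv (deriv \<Phi>)\<close> is meaningful only with differentiability; together they are
    one derivative statement.\<close>
  have field: "deriv \<Phi> differentiable (at t) \<and>
        deriv (deriv \<Phi>) t + 3 * hubble a t * deriv \<Phi> t + m\<^sup>2 * \<Phi> t = 0
      \<longleftrightarrow> (deriv \<Phi> has_real_derivative - (3 * hubble a t * deriv \<Phi> t) - m\<^sup>2 * \<Phi> t) (at t)"
    (is "_ \<and> ?E \<longleftrightarrow> (_ has_real_derivative ?d) _") for t
  proof -
    have "?E \<longleftrightarrow> deriv (deriv \<Phi>) t = ?d"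
      by linarith
    then show ?thesis
      by (metis DERIV_deriv_iff_real_differentiable DERIV_imp_deriv real_differentiable_def)
  qed
  have "friedmann_scalar_solution m t0 a \<Phi> \<longleftrightarrow>
      (\<forall>t>t0. a t > 0 \<and> a differentiable (at t) \<and> hubble a t = h t \<and> \<Phi> differentiable (at t) \<and>
        (deriv \<Phi> has_real_derivative - (3 * h t * deriv \<Phi> t) - m\<^sup>2 * \<Phi> t) (at t))"
    unfolding friedmann_scalar_solution_def
    using branch field by (simp add: hubble_def[symmetric]) metis
  also have "\<dots> \<longleftrightarrow> (\<forall>t>t0. a t > 0 \<and> a differentiable (at t) \<and> hubble a t = h t) \<and>
      solves_from phase_field (m * t0) (phase_curve m \<Phi>)"
    unfolding solves_from_phase_curve_iff[OF m] h_def by blast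
  also have "\<dots> \<longleftrightarrow> (\<forall>t>t0. a t > 0 \<and> a differentiable (at t) \<and>
           hubble a t = m * sqrt (8 * pi / 3) *
             sqrt ((phase_curve m \<Phi> (m * t) $ 2)\<^sup>2 + (phase_curve m \<Phi> (m * t) $ 1)\<^sup>2)) \<and>
        solves_from phase_field (m * t0) (phase_curve m \<Phi>)"
    unfolding solves_from_phase_curve_iff[OF m] h_def
    using phase_curve_1[OF m] phase_curve_2[OF m] by auto
  finally show ?thesis .
qed

section \<open>The singular point and its linearisation\<close>

lemma phase_field_eq_0_iff: "phase_field M = 0 \<longleftrightarrow> M = 0"
  by (auto simp: phase_field_def vec_eq_iff forall_2)

text \<open>The square root in the friction is the Euclidean norm, which is not differentiable at 0,
  so the derivative is taken from its definition. The friction is at most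
  \<open>sqrt (24 * pi)\<close> times the squared norm and drops out, leaving an infinitesimal
  rotation.\<close>

lemma phase_field_has_derivative_at_0:
  "(phase_field has_derivative (\<lambda>h. vector [h $ 2, - h $ 1])) (at 0)"
  unfolding has_derivative_at
proof
  show "bounded_linear (\<lambda>h :: real^2. vector [h $ 2, - h $ 1] :: real^2)"
    by (intro linear_conv_bounded_linear[THEN iffD1] linearI) (auto simp: vec_eq_iff forall_2)
  have norm2: "norm h = sqrt ((h $ 2)\<^sup>2 + (h $ 1)\<^sup>2)" for h :: "real^2"
    by (simp add: norm_vec_def L2_set_def sum_2 add.commute)
  have remainder: "phase_field (0 + h) - phase_field 0 - vector [h $ 2, - h $ 1]
      = vector [0, - sqrt (24 * pi) * norm h * h $ 2]" for h
    unfolding norm2 by (simp add: phase_field_def vec_eq_iff forall_2)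
  have "norm (norm (phase_field (0 + h) - phase_field 0 - vector [h $ 2, - h $ 1]) / norm h)
      \<le> sqrt (24 * pi) * norm h" for h
  proof -
    have "norm (vector [0, - sqrt (24 * pi) * norm h * h $ 2] :: real^2)
        = sqrt (24 * pi) * norm h * \<bar>h $ 2\<bar>"
      by (subst norm2) (simp add: abs_mult)
    also have "\<dots> \<le> sqrt (24 * pi) * norm h * norm h"
      using component_le_norm_cart[of h 2] by (intro mult_left_mono) auto
    finally show ?thesis
      unfolding remainder by (cases "h = 0") (simp_all add: divide_simps)
  qed
  then have "\<forall>\<^sub>F h in at 0. norm (norm (phase_field (0 + h) - phase_field 0 - vector [h $ 2, - h $ 1]) / norm h)
      \<le> sqrt (24 * pi) * norm h"
    by simp
  moreover have "((\<lambda>h::real^2. sqrt (24 * pi) * norm h) \<longlongrightarrow> 0) (at 0)"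
    by (auto intro!: tendsto_eq_intros)
  ultimately show "(\<lambda>h. norm (phase_field (0 + h) - phase_field 0 - vector [h $ 2, - h $ 1]) / norm h) \<midarrow>0\<rightarrow> 0"
    by (rule Lim_null_comparison)
qed

text \<open>An eigenvector must have nonzero first component, which forces \<mu> squared to be -1;
  conversely \<open>vector [1, \<mu>]\<close> is then an eigenvector.\<close>

lemma complex_eigenvalue_rotation_iff:
  "complex_eigenvalue (matrix (\<lambda>h :: real^2. vector [h $ 2, - h $ 1])) \<mu> \<longleftrightarrow> \<mu> = \<i> \<or> \<mu> = - \<i>"
proof -
  define A :: "real^2^2" where "A = matrix (\<lambda>h. vector [h $ 2, - h $ 1])"
  have A: "A $ 1 $ 1 = 0" "A $ 1 $ 2 = 1" "A $ 2 $ 1 = -1" "A $ 2 $ 2 = 0"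
    by (simp_all add: A_def matrix_def axis_def)
  have eq_iff: "map_matrix complex_of_real A *v v = \<mu> *s v \<longleftrightarrow> v $ 2 = \<mu> * v $ 1 \<and> - v $ 1 = \<mu> * v $ 2"
    for v
    by (simp add: vec_eq_iff forall_2 matrix_vector_mult_def sum_2 map_matrix_def A)
  have "complex_eigenvalue A \<mu> \<longleftrightarrow> \<mu> * \<mu> = - 1"
  proof
    assume "complex_eigenvalue A \<mu>"
    then obtain v where v: "v \<noteq> 0" "map_matrix complex_of_real A *v v = \<mu> *s v"
      unfolding complex_eigenvalue_def by blast
    note v2 = v(2)[unfolded eq_iff, THEN conjunct1] and v1 = v(2)[unfolded eq_iff, THEN conjunct2]
    have "v $ 1 \<noteq> 0"
    proof
      assume "v $ 1 = 0"
      then have "v $ 2 = 0"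
        using v2 by simp
      with \<open>v $ 1 = 0\<close> v(1) show False
        by (simp add: vec_eq_iff forall_2)
    qed
    moreover have "\<mu> * \<mu> * v $ 1 = - 1 * v $ 1"
      using v1[unfolded v2] by simp
    ultimately show "\<mu> * \<mu> = - 1"
      by (metis mult_right_cancel)
  next
    assume "\<mu> * \<mu> = - 1"
    then have "map_matrix complex_of_real A *v vector [1, \<mu>] = \<mu> *s vector [1, \<mu>]"
      unfolding eq_iff by simp
    moreover have "(vector [1, \<mu>] :: complex^2) \<noteq> 0"
      by (simp add: vec_eq_iff forall_2)
    ultimately show "complex_eigenvalue A \<mu>"
      unfolding complex_eigenvalue_def by blast
  qed
  also have "\<dots> \<longleftrightarrow> \<mu>\<^sup>2 = \<i>\<^sup>2"
    by (simp add: power2_eq_square)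
  finally show ?thesis
    unfolding A_def power2_eq_iff .
qed

lemma is_center_phase_field_iff: "is_center phase_field M \<longleftrightarrow> M = vector [0, 0]"
proof -
  have zero: "(vector [0, 0] :: real^2) = 0"
    by (simp add: vec_eq_iff forall_2)
  have "is_center phase_field 0"
    unfolding is_center_def
  \<comment> \<open>The frequency is 1 in the time \<tau>, that is \<open>m\<close> in the time
    \<open>t\<close>.\<close>
  proof (intro conjI exI[of _ "1::real"])
    show "phase_field differentiable (at 0)"
      using phase_field_has_derivative_at_0 by (auto simp: differentiable_def)
    show "{\<mu>. complex_eigenvalue (matrix (frechet_derivative phase_field (at 0))) \<mu>}
        = {\<i> * complex_of_real 1, - \<i> * complex_of_real 1}"
      unfolding frechet_derivative_at[OF phase_field_has_derivative_at_0, symmetric]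
      by (auto simp: complex_eigenvalue_rotation_iff)
  qed (simp_all add: phase_field_eq_0_iff)
  moreover have "M = 0" if "is_center phase_field M"
    using that by (simp add: is_center_def phase_field_eq_0_iff)
  ultimately show ?thesis
    unfolding zero by blast
qed

section \<open>Late-time behaviour of the cosmological solutions\<close>

lemma friedmann_scalar_solution_asymptotics:
  assumes m: "m > 0" and sol: "friedmann_scalar_solution m t0 a \<Phi>"
  shows "(\<Phi> \<longlongrightarrow> 0) at_top \<and> (deriv \<Phi> \<longlongrightarrow> 0) at_top \<and> (hubble a \<longlongrightarrow> 0) at_top
          \<and> \<not> comes_to_constant_inflation a
          \<and> expansion_stops a
          \<and> asymptotically_minkowski a"
proof -
  define \<kappa> where "\<kappa> = sqrt (8 * pi / 3)"
  define x where "x = phase_curve m \<Phi>"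
  have solves: "solves_from phase_field (m * t0) x"
    and a_pos: "\<And>t. t > t0 \<Longrightarrow> a t > 0"
    and a_diff: "\<And>t. t > t0 \<Longrightarrow> a differentiable (at t)"
    and hubble_a: "\<And>t. t > t0 \<Longrightarrow>
      hubble a t = m * \<kappa> * sqrt ((x (m * t) $ 2)\<^sup>2 + (x (m * t) $ 1)\<^sup>2)"
    using sol unfolding friedmann_scalar_solution_iff[OF m] x_def \<kappa>_def by auto
  have \<Phi>_diff: "\<Phi> differentiable (at t)" if "t > t0" for t
    using sol that by (simp add: friedmann_scalar_solution_def)
  interpret damped_oscillator \<kappa> "m * t0" "\<lambda>\<tau>. x \<tau> $ 1" "\<lambda>\<tau>. x \<tau> $ 2"
    unfolding \<kappa>_def using solves by (rule solves_from_phase_field_imp_damped_oscillator)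
  define H where "H t = m * \<kappa> * r (m * t)" for t
  \<comment> \<open>\<open>G\<close> is the derivative of \<open>H\<close> wherever \<open>r\<close>
    has the derivative \<open>- 3 * \<kappa> * z^2\<close>; the chain rule contributes the second
    factor \<open>m\<close>.\<close>
  define G where "G t = - 3 * m\<^sup>2 * \<kappa>\<^sup>2 * (x (m * t) $ 2)\<^sup>2" for t
  have rescale: "((\<lambda>t. f (m * t)) \<longlongrightarrow> l) at_top" if "(f \<longlongrightarrow> l) at_top" for f and l :: real
    using that by (rule filterlim_compose)
      (rule filterlim_tendsto_pos_mult_at_top[OF tendsto_const m filterlim_ident])
  have H_eq: "hubble a t = H t" if "t > t0" for t
    using hubble_a[OF that] by (simp add: H_def r_def)
  have deriv_a_eq: "deriv a t = H t * a t" if "t > t0" for t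
    using H_eq[OF that] a_pos[OF that] by (simp add: hubble_def field_simps)
  have deriv_a: "(a has_real_derivative H t * a t) (at t)" if "t > t0" for t
    using a_diff[OF that] deriv_a_eq[OF that] by (metis DERIV_deriv_iff_real_differentiable)
  have H_0: "(H \<longlongrightarrow> 0) at_top"
    unfolding H_def by (auto intro!: tendsto_eq_intros rescale[OF r_tendsto_0])
  have G_0: "(G \<longlongrightarrow> 0) at_top"
    unfolding G_def
    by (rule tendsto_mult_right_zero) (use tendsto_power[OF rescale[OF z_tendsto_0], of 2] in simp)
  have ev: "\<forall>\<^sub>F t in at_top. t > t0"
    by (rule eventually_gt_at_top)

  have "((\<lambda>t. x (m * t) $ 1) \<longlongrightarrow> 0) at_top"
    using rescale[OF \<phi>_tendsto_0] .
  then have \<Phi>_0: "(\<Phi> \<longlongrightarrow> 0) at_top"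
    using m by (simp add: x_def phase_curve_1)
  have "((\<lambda>t. m * x (m * t) $ 2) \<longlongrightarrow> 0) at_top"
    by (intro tendsto_mult_right_zero rescale[OF z_tendsto_0])
  moreover have "\<forall>\<^sub>F t in at_top. m * x (m * t) $ 2 = deriv \<Phi> t"
    using ev by eventually_elim (use m in \<open>simp add: x_def phase_curve_2 \<Phi>_diff\<close>)
  ultimately have deriv_\<Phi>_0: "(deriv \<Phi> \<longlongrightarrow> 0) at_top"
    by (rule Lim_transform_eventually)
  have "\<forall>\<^sub>F t in at_top. H t = hubble a t"
    using ev by eventually_elim (simp add: H_eq)
  with H_0 have hubble_0: "(hubble a \<longlongrightarrow> 0) at_top"
    by (rule Lim_transform_eventually)

  \<comment> \<open>In the time \<tau> the logarithmic derivative of the scale factor is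
    \<open>H / m = \<kappa> * r\<close>, as required of \<open>b\<close>; up to
    \<open>m * \<kappa>\<close> the product is \<open>deriv a\<close>.\<close>
  have "((\<lambda>\<tau>. a (\<tau> / m) * r \<tau>) \<longlongrightarrow> 0) at_top"
  proof (rule scale_factor_mult_r_tendsto_0)
    fix \<tau> assume "\<tau> > m * t0"
    then have t: "\<tau> / m > t0"
      using m by (simp add: field_simps)
    then show "a (\<tau> / m) > 0"
      by (rule a_pos)
    show "((\<lambda>\<tau>. a (\<tau> / m)) has_real_derivative \<kappa> * r \<tau> * a (\<tau> / m)) (at \<tau>)"
      using scaled_field_has_derivative_iff[OF m, of a "\<kappa> * r \<tau> * a (\<tau> / m)" "\<tau> / m"] deriv_a[OF t] m
      by (simp add: scaled_field_def[abs_def] H_def mult.assoc)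
  qed
  from rescale[OF this] have "((\<lambda>t. a t * r (m * t)) \<longlongrightarrow> 0) at_top"
    using m by simp
  then have "((\<lambda>t. m * \<kappa> * (a t * r (m * t))) \<longlongrightarrow> 0) at_top"
    by (rule tendsto_mult_right_zero)
  moreover have "\<forall>\<^sub>F t in at_top. m * \<kappa> * (a t * r (m * t)) = deriv a t"
    using ev by eventually_elim (simp add: deriv_a_eq H_def)
  ultimately have deriv_a_0: "(deriv a \<longlongrightarrow> 0) at_top"
    by (rule Lim_transform_eventually)

  obtain \<tau>1 where \<tau>1: "\<tau>1 \<ge> m * t0"
    and deriv_r: "\<And>\<tau>. \<tau> > \<tau>1 \<Longrightarrow> (r has_real_derivative - 3 * \<kappa> * (x \<tau> $ 2)\<^sup>2) (at \<tau>)"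
    using eventually_deriv_r by blast
  have "asymptotically_minkowski a"
  proof (rule asymptotically_minkowskiI[OF _ _ _ H_0 G_0])
    \<comment> \<open>The start is moved beyond \<open>t0\<close> because \<open>r\<close>, and with
      it \<open>H\<close>, is known to be differentiable only after \<open>\<tau>1\<close>.\<close>
    fix t assume "t > \<tau>1 / m"
    then have t: "m * t > \<tau>1"
      using m by (simp add: field_simps)
    then have t': "t > t0"
      using \<tau>1 m by (metis le_less_trans mult_less_cancel_left_pos)
    show "a t > 0" "(a has_real_derivative H t * a t) (at t)"
      using t' by (rule a_pos, rule deriv_a)
    have "((\<lambda>t. r (m * t)) has_real_derivative - 3 * \<kappa> * (x (m * t) $ 2)\<^sup>2 * m) (at t)"
      by (rule DERIV_chain2[where g = "\<lambda>t. m * t", OF deriv_r[OF t]]) (auto intro!: derivative_eq_intros)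
    from DERIV_cmult[OF this, of "m * \<kappa>"] show "(H has_real_derivative G t) (at t)"
      by (simp add: H_def[abs_def] G_def power2_eq_square algebra_simps)
  qed
  moreover have "\<not> comes_to_constant_inflation a"
    using a_pos deriv_a H_0 by (rule not_comes_to_constant_inflationI)
  ultimately show ?thesis
    using \<Phi>_0 deriv_\<Phi>_0 hubble_0 deriv_a_0 by (simp add: expansion_stops_def)
qed

theorem mainTheorem1:
  fixes m :: real
  assumes "m > 0"
  shows
    "(\<forall>t0 a \<Phi>. friedmann_scalar_solution m t0 a \<Phi> \<longleftrightarrow>
        (\<forall>t>t0. a t > 0 \<and> a differentiable (at t) \<and>
           hubble a t = m * sqrt (8 * pi / 3) *
             sqrt ((phase_curve m \<Phi> (m * t) $ 2)\<^sup>2 + (phase_curve m \<Phi> (m * t) $ 1)\<^sup>2)) \<and>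
        solves_from phase_field (m * t0) (phase_curve m \<Phi>))
     \<and> {M. is_center phase_field M} = {vector [0, 0]}
     \<and> (\<forall>\<tau>0 x. solves_from phase_field \<tau>0 x \<longrightarrow> (x \<longlongrightarrow> vector [0, 0]) at_top)
     \<and> (\<forall>t0 a \<Phi>. friedmann_scalar_solution m t0 a \<Phi> \<longrightarrow>
          (\<Phi> \<longlongrightarrow> 0) at_top \<and> (deriv \<Phi> \<longlongrightarrow> 0) at_top \<and> (hubble a \<longlongrightarrow> 0) at_top
          \<and> \<not> comes_to_constant_inflation a
          \<and> expansion_stops a
          \<and> asymptotically_minkowski a)"
  using friedmann_scalar_solution_iff[OF assms] is_center_phase_field_iff
    solves_from_phase_field_tendsto friedmann_scalar_solution_asymptotics[OF assms]
  by (intro conjI allI impI) auto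

end
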